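(* Let $v_1, v_2, \dots, v_n$ be real numbers such that $\sum_{i=1}^n v_i^2 \le 1$. Let $a_1, a_2, \dots, a_n$ be independent random signs, and let $S = \sum_{i=1}^n a_i v_i$. Then \[ \Pr[\,|S| \le 1\,] > \frac{13}{32}. \]
   Context: A random sign is a random variable uniformly distributed on $\{-1,+1\}$. *)

theory Defs
  imports "HOL-Probability.Probability"
begin

(* A real random variable whose law is the uniform distribution on {-1, 1}.  The values are
   only constrained almost surely. *)
definition random_sign :: "'a measure \<Rightarrow> ('a \<Rightarrow> real) \<Rightarrow> bool" where
  "random_sign M X \<longleftrightarrow>
     X \<in> borel_measurable M \<and>
     distr M borel X = distr (measure_pmf (pmf_of_set {-1, 1})) borel (\<lambda>x. x)"

end

theory Submission
  imports Defs
begin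

text \<open>
The signs are revealed one at a time, giving a walk that starts at \<open>0\<close>. Suppose the walk is at
\<open>x\<close> with \<open>\<bar>x\<bar> \<le> 1\<close> and the unrevealed part \<open>Y\<close> has variance \<open>\<sigma>\<^sup>2\<close>. Since \<open>Y\<close> is symmetric and at least
one of \<open>x + Y\<close>, \<open>x - Y\<close> lies in \<open>[-1, 1]\<close> as soon as \<open>\<bar>Y\<bar> \<le> 1 + \<bar>x\<bar>\<close>, the fourth moment bound
\<open>E Y^4 \<le> 3 \<sigma>^4\<close> and Markov's inequality show that the walk ends in \<open>[-1, 1]\<close> with probability at least
\<open>1/2 - 3/2 * \<rho>\<^sup>2\<close>, where \<open>\<rho> = \<sigma>\<^sup>2 / (1 + \<bar>x\<bar>)\<^sup>2\<close> (\<open>in_unit_prob_ge\<close>). As \<open>1/2 - 3/2 * 1/16 = 13/32\<close>, it is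
enough to reveal signs until either \<open>\<bar>x\<bar>\<close> is so large or so much variance is spent that \<open>\<rho>\<^sup>2\<close> is below \<open>1/16\<close>
on average.

Let \<open>u\<^sub>1 \<ge> u\<^sub>2 \<ge> u\<^sub>3 \<ge> \<dots>\<close> be the absolute values of the weights. They are used in the order
\<open>u\<^sub>2, u\<^sub>4, u\<^sub>5, \<dots>, u\<^sub>3, u\<^sub>1\<close>. The last two are harmless: from any point of \<open>[-1, 1]\<close> the two steps \<open>u\<^sub>3, u\<^sub>1\<close>
lead back into \<open>[-1, 1]\<close> with probability at least \<open>1/2\<close> (\<open>in_unit_two_steps_ge\<close>). For the others, which
form a decreasing sequence \<open>y\<^sub>1, y\<^sub>2, \<dots>\<close>, this order ensures \<open>y\<^sub>1 + y\<^sub>2 \<le> 1\<close>: otherwise the four largest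
squares would add up to more than \<open>1\<close>.

If \<open>y\<^sub>1 + y\<^sub>2 + \<dots> \<le> 1\<close>, the walk never leaves \<open>[-1, 1]\<close> before the last two steps. Otherwise take the
longest prefix whose sum \<open>s\<close> is at most \<open>1\<close>, let \<open>U\<close> be the sum of the squares in that prefix, and let \<open>w\<close> be
the next term, so that \<open>s + w > 1\<close>. The prefix has at least two terms, so with probability at most
\<open>1/2\<close> all its signs agree and the walk is at \<open>s\<close> or \<open>-s\<close>. There the estimate is applied at once, with
\<open>\<rho> \<le> R\<close>. In all other cases the walk is within \<open>s - 2 * w\<close> of \<open>0\<close>, two further steps cannot leave
\<open>[-1, 1]\<close>, and the walk goes on until the next term \<open>z\<close> could take it out. By then the square of \<open>w\<close>
and one more square, at least \<open>z\<^sup>2\<close>, have been spent, which gives a smaller bound \<open>\<rho> \<le> r\<close>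
(\<open>signed_mean_ge_if_variance_spent\<close>). The elementary inequality \<open>R\<^sup>2 + r\<^sup>2 < 1/8\<close> (\<open>variance_ratios\<close>)
completes the argument in \<open>in_unit_walk_gt\<close>.

The walk is handled through the recursive average \<open>signed_mean\<close> over all sign patterns;
\<open>integral_PiM_uniform_sign\<close> identifies this average with the expectation over independent random signs.
\<close>

section \<open>Averages over all choices of signs\<close>

primrec signed_mean :: "(real \<Rightarrow> real) \<Rightarrow> real list \<Rightarrow> real \<Rightarrow> real" where
  "signed_mean f [] x = f x"
| "signed_mean f (v # vs) x = (signed_mean f vs (x + v) + signed_mean f vs (x - v)) / 2"

lemma signed_mean_append:
  "signed_mean f (xs @ ys) x = signed_mean (signed_mean f ys) xs x"
  by (induction xs arbitrary: x) auto

lemma signed_mean_snoc_zeros: "signed_mean f (xs @ replicate k 0) x = signed_mean f xs x"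
proof -
  have "signed_mean f (replicate k 0) = f"
    by (induction k) auto
  then show ?thesis by (simp add: signed_mean_append)
qed

lemma signed_mean_abs: "signed_mean f (map abs vs) x = signed_mean f vs x"
proof (induction vs arbitrary: x)
  case (Cons v vs)
  then show ?case by (cases "v \<ge> 0") auto
qed simp

lemma signed_mean_move_front:
  "signed_mean f (xs @ v # ys) x = signed_mean f (v # xs @ ys) x"
  by (induction xs arbitrary: x) (auto simp: algebra_simps add_divide_distrib)

text \<open>The average does not depend on the order of the steps, so the order can be chosen to suit
the argument.\<close>

lemma signed_mean_mset_cong:
  "mset xs = mset ys \<Longrightarrow> signed_mean f xs x = signed_mean f ys x"
proof (induction xs arbitrary: ys x)
  case (Cons v xs)
  then have "v \<in> set ys"
    by (metis list.set_intros(1) mset_eq_setD)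
  then obtain us ws where ys: "ys = us @ v # ws"
    by (meson split_list)
  with Cons.prems have "mset xs = mset (us @ ws)" by simp
  then have "signed_mean f xs = signed_mean f (us @ ws)"
    using Cons.IH by blast
  then show ?case by (simp only: ys signed_mean_move_front signed_mean.simps)
qed simp

lemma signed_mean_translate:
  "signed_mean f vs (x + y) = signed_mean (\<lambda>z. f (x + z)) vs y"
  by (induction vs arbitrary: y) (simp_all add: add.assoc flip: add_diff_eq)

lemma signed_mean_reflect:
  "signed_mean (\<lambda>z. f (- z)) vs x = signed_mean f vs (- x)"
proof (induction vs arbitrary: x)
  case (Cons v vs)
  have "- (x + v) = - x - v" "- (x - v) = - x + v" by auto
  with Cons show ?case by simp
qed simp

lemma signed_mean_even:
  assumes "\<And>z. f (- z) = f z"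
  shows "signed_mean f vs (- x) = signed_mean f vs x"
  using signed_mean_reflect[of f vs x] assms by simp

lemma signed_mean_add:
  "signed_mean (\<lambda>z. f z + g z) vs x = signed_mean f vs x + signed_mean g vs x"
  by (induction vs arbitrary: x) (auto simp: field_simps)

lemma signed_mean_affine:
  "signed_mean (\<lambda>z. a + b * f z) vs x = a + b * signed_mean f vs x"
  by (induction vs arbitrary: x) (auto simp: field_simps)

lemma signed_mean_mono:
  "(\<And>z. f z \<le> g z) \<Longrightarrow> signed_mean f vs x \<le> signed_mean g vs x"
  by (induction vs arbitrary: x) (auto intro: add_mono)

text \<open>A walk whose steps add up to at most \<open>B - \<bar>x\<bar>\<close> is confined to \<open>[-B, B]\<close>, so a lower bound there
passes to the average.\<close>

lemma signed_mean_ge: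
  assumes "\<forall>v\<in>set vs. 0 \<le> v" "\<bar>x\<bar> + sum_list vs \<le> B"
    and "\<And>z. \<bar>z\<bar> \<le> B \<Longrightarrow> c \<le> f z"
  shows "c \<le> signed_mean f vs x"
  using assms(1,2)
proof (induction vs arbitrary: x)
  case (Cons v vs)
  from Cons.prems have "\<bar>x + v\<bar> + sum_list vs \<le> B" "\<bar>x - v\<bar> + sum_list vs \<le> B"
    by auto
  with Cons.prems Cons.IH have "c \<le> signed_mean f vs (x + v)" "c \<le> signed_mean f vs (x - v)"
    by auto
  then show ?case by simp
qed (use assms(3) in auto)

section \<open>The fourth moment estimate\<close>

abbreviation sum_sq :: "real list \<Rightarrow> real" where
  "sum_sq vs \<equiv> sum_list (map (\<lambda>v. v\<^sup>2) vs)"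

lemma sum_sq_nonneg: "0 \<le> sum_sq vs"
  by (intro sum_list_nonneg) auto

definition in_unit :: "real \<Rightarrow> real" where
  "in_unit x = (if \<bar>x\<bar> \<le> 1 then 1 else 0)"

lemma in_unit_minus: "in_unit (- x) = in_unit x"
  by (simp add: in_unit_def)

text \<open>The bound keeps track of the starting point because the induction shifts it: the average of
\<open>(x + v)^4\<close> and \<open>(x - v)^4\<close> is \<open>x^4 + 6 * x\<^sup>2 * v\<^sup>2 + v^4\<close>, and at \<open>x = 0\<close> only \<open>3 \<sigma>^4\<close> survives.\<close>

lemma signed_mean_fourth_moment:
  "signed_mean (\<lambda>z. z ^ 4) vs x \<le> x ^ 4 + 6 * x\<^sup>2 * sum_sq vs + 3 * (sum_sq vs)\<^sup>2"
proof (induction vs arbitrary: x)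
  case (Cons v vs)
  let ?S = "sum_sq vs"
  have "signed_mean (\<lambda>z. z ^ 4) (v # vs) x \<le>
      (((x + v) ^ 4 + 6 * (x + v)\<^sup>2 * ?S + 3 * ?S\<^sup>2) +
       ((x - v) ^ 4 + 6 * (x - v)\<^sup>2 * ?S + 3 * ?S\<^sup>2)) / 2"
    using Cons[of "x + v"] Cons[of "x - v"] by simp
  also have "\<dots> = x ^ 4 + 6 * x\<^sup>2 * (v\<^sup>2 + ?S) + 3 * (v\<^sup>2 + ?S)\<^sup>2 - 2 * v ^ 4"
    by (simp add: power4_eq_xxxx power2_eq_square algebra_simps)
  also have "\<dots> \<le> x ^ 4 + 6 * x\<^sup>2 * (v\<^sup>2 + ?S) + 3 * (v\<^sup>2 + ?S)\<^sup>2"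
    by simp
  finally show ?case by simp
qed simp

text \<open>If \<open>\<bar>y\<bar> \<le> 1 + x\<close>, then subtracting \<open>\<bar>y\<bar>\<close> from \<open>x\<close> gives a point of \<open>[-1, x]\<close>; for larger \<open>\<bar>y\<bar>\<close>
the left-hand side is not positive.\<close>

lemma in_unit_pair_ge:
  assumes "0 \<le> x" "x \<le> 1"
  shows "1 - y ^ 4 / (1 + x) ^ 4 \<le> in_unit (x + y) + in_unit (x - y)"
proof (cases "\<bar>y\<bar> \<le> 1 + x")
  case True
  then have "1 \<le> in_unit (x + y) + in_unit (x - y)"
    using assms by (auto simp: in_unit_def)
  moreover have "0 \<le> y ^ 4 / (1 + x) ^ 4" by simp
  ultimately show ?thesis by linarith
next
  case False
  then have "(1 + x) ^ 4 \<le> \<bar>y\<bar> ^ 4"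
    using assms by (intro power_mono) auto
  moreover have "0 < (1 + x) ^ 4" using assms by simp
  ultimately have "1 \<le> y ^ 4 / (1 + x) ^ 4" by simp
  moreover have "0 \<le> in_unit (x + y) + in_unit (x - y)" by (simp add: in_unit_def)
  ultimately show ?thesis by linarith
qed

text \<open>The basic estimate, with \<open>r\<close> an upper bound for the ratio of the remaining variance to
\<open>(1 + \<bar>x\<bar>)\<^sup>2\<close>. Averaging the previous inequality over the signed sums \<open>y\<close> gives twice the probability
on the right, because these sums are symmetric.\<close>

lemma in_unit_prob_ge:
  assumes "\<bar>x\<bar> \<le> 1" "sum_sq vs \<le> r * (1 + \<bar>x\<bar>)\<^sup>2"
  shows "1/2 - 3/2 * r\<^sup>2 \<le> signed_mean in_unit vs x"
proof -
  define t where "t = \<bar>x\<bar>"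
  have t: "0 \<le> t" "t \<le> 1" using assms by (auto simp: t_def)
  have pos: "0 < (1 + t) ^ 4" using t by simp
  have "(sum_sq vs)\<^sup>2 \<le> (r * (1 + t)\<^sup>2)\<^sup>2"
    using assms(2) sum_sq_nonneg by (intro power_mono) (auto simp: t_def)
  also have "\<dots> = r\<^sup>2 * (1 + t) ^ 4" by (simp add: power_mult_distrib)
  finally have le: "(sum_sq vs)\<^sup>2 / (1 + t) ^ 4 \<le> r\<^sup>2"
    using pos by (simp add: divide_le_eq)
  have "signed_mean (\<lambda>z. z ^ 4) vs 0 \<le> 3 * (sum_sq vs)\<^sup>2"
    using signed_mean_fourth_moment[of vs 0] by simp
  then have "signed_mean (\<lambda>z. z ^ 4) vs 0 / (1 + t) ^ 4 \<le> 3 * (sum_sq vs)\<^sup>2 / (1 + t) ^ 4"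
    using pos by (intro divide_right_mono) auto
  with le have "1 - 3 * r\<^sup>2 \<le> 1 + (- 1 / (1 + t) ^ 4) * signed_mean (\<lambda>z. z ^ 4) vs 0"
    by simp
  also have "\<dots> = signed_mean (\<lambda>z. 1 + (- 1 / (1 + t) ^ 4) * z ^ 4) vs 0"
    by (rule signed_mean_affine[symmetric])
  also have "\<dots> \<le> signed_mean (\<lambda>z. in_unit (t + z) + in_unit (t + - z)) vs 0"
    using in_unit_pair_ge[OF t] by (intro signed_mean_mono) simp
  also have "\<dots> = signed_mean (\<lambda>z. in_unit (t + z)) vs 0 + signed_mean (\<lambda>z. in_unit (t + z)) vs (- 0)"
    unfolding signed_mean_add by (simp only: signed_mean_reflect[of "\<lambda>z. in_unit (t + z)"])
  also have "\<dots> = 2 * signed_mean in_unit vs t"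
    using signed_mean_translate[of in_unit vs t 0] by simp
  also have "signed_mean in_unit vs t = signed_mean in_unit vs x"
    by (cases "x \<ge> 0") (auto simp: t_def signed_mean_even in_unit_minus)
  finally show ?thesis by simp
qed

section \<open>Phases of the walk\<close>

text \<open>For \<open>x \<ge> 0\<close>, the point \<open>x - p + q\<close> always lies in \<open>[-1, 1]\<close>. So does \<open>x - p - q\<close> if
\<open>p + q \<le> 1 + x\<close>, and \<open>x + p - q\<close> otherwise, since then \<open>x < p + q - 1 \<le> 1 - p + q\<close>.\<close>

lemma in_unit_two_steps_ge:
  assumes "0 \<le> q" "q \<le> p" "p \<le> 1" "\<bar>x\<bar> \<le> 1"
  shows "1/2 \<le> signed_mean in_unit [q, p] x"
  using assms by (auto simp: in_unit_def)

text \<open>The walk after the variance \<open>A\<close> and the step \<open>m\<close> have been spent. It continues with the decreasing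
steps \<open>vs\<close> until the next step \<open>v\<close> satisfies \<open>\<bar>x\<bar> + v > 1\<close>. Then \<open>1 + \<bar>x\<bar> > 2 - v\<close>, while the latest
step spent is at least \<open>v\<close>, so the remaining variance is at most \<open>1 - A - v\<^sup>2\<close>. This is why the ratio
is controlled for each \<open>z\<close> in \<open>[0, w]\<close> as a possible stopping step.\<close>

lemma signed_mean_ge_if_variance_spent:
  assumes tail: "\<And>x. \<bar>x\<bar> \<le> 1 \<Longrightarrow> 1/2 \<le> signed_mean in_unit zs x"
    and bound: "\<And>z. 0 \<le> z \<Longrightarrow> z \<le> w \<Longrightarrow> 1 - A - z\<^sup>2 \<le> r * (2 - z)\<^sup>2"
    and "0 \<le> r"
    and "sorted_wrt (\<ge>) (m # vs)" "\<forall>v\<in>set (m # vs). 0 \<le> v" "m \<le> w" "w \<le> 1"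
    and "\<bar>x\<bar> \<le> 1" "sum_sq (vs @ zs) \<le> 1 - A - m\<^sup>2"
  shows "1/2 - 3/2 * r\<^sup>2 \<le> signed_mean in_unit (vs @ zs) x"
  using assms(4-)
proof (induction vs arbitrary: m x)
  case Nil
  have "1/2 - 3/2 * r\<^sup>2 \<le> 1/2" by simp
  also have "1/2 \<le> signed_mean in_unit zs x" using Nil by (intro tail)
  finally show ?case by simp
next
  case (Cons v vs)
  have v: "0 \<le> v" "v \<le> m" "v \<le> w" using Cons.prems by auto
  have vm: "v\<^sup>2 \<le> m\<^sup>2" using v by (intro power_mono) auto
  show ?case
  proof (cases "\<bar>x\<bar> + v \<le> 1")
    case True
    have "v\<^sup>2 + sum_sq (vs @ zs) \<le> 1 - A - m\<^sup>2"
      using Cons.prems(6) by simp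
    then have rest: "sum_sq (vs @ zs) \<le> 1 - A - v\<^sup>2"
      using zero_le_power2[of m] by linarith
    have "1/2 - 3/2 * r\<^sup>2 \<le> signed_mean in_unit (vs @ zs) y" if "\<bar>y\<bar> \<le> 1" for y
      using Cons.prems v rest that by (intro Cons.IH[of v]) auto
    moreover have "\<bar>x + v\<bar> \<le> 1" "\<bar>x - v\<bar> \<le> 1" using True v by auto
    ultimately have "1/2 - 3/2 * r\<^sup>2 \<le> signed_mean in_unit (vs @ zs) (x + v)"
      "1/2 - 3/2 * r\<^sup>2 \<le> signed_mean in_unit (vs @ zs) (x - v)" by blast+
    then show ?thesis by simp
  next
    case False
    have "sum_sq ((v # vs) @ zs) \<le> 1 - A - v\<^sup>2"
      using Cons.prems(6) vm by linarith
    also have "\<dots> \<le> r * (2 - v)\<^sup>2" using v by (intro bound)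
    also have "\<dots> \<le> r * (1 + \<bar>x\<bar>)\<^sup>2"
      using False v Cons.prems \<open>0 \<le> r\<close> by (intro mult_left_mono power_mono) auto
    finally show ?thesis by (intro in_unit_prob_ge Cons.prems)
  qed
qed

text \<open>Either all steps go up, or some step of size at least \<open>w\<close> goes down and the final point is
closer to \<open>0\<close> by at least \<open>2 * w\<close>. The assumption \<open>w \<le> x\<close> covers the down-steps that carry the walk
below \<open>0\<close>.\<close>

lemma signed_mean_ge_extremal:
  assumes "0 \<le> w" "\<forall>h\<in>set hs. w \<le> h" "w \<le> x"
    and "c \<le> f (x + sum_list hs)"
    and "\<And>z. \<bar>z\<bar> \<le> x + sum_list hs - 2 * w \<Longrightarrow> c \<le> f z"
  shows "c \<le> signed_mean f hs x"
  using assms(2-)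
proof (induction hs arbitrary: x)
  case (Cons h hs)
  have "c \<le> signed_mean f hs (x + h)"
    using Cons.prems \<open>0 \<le> w\<close> by (intro Cons.IH) (auto simp: add.assoc)
  moreover have "c \<le> signed_mean f hs (x - h)"
    using Cons.prems \<open>0 \<le> w\<close>
    by (intro signed_mean_ge[where B = "x + sum_list (h # hs) - 2 * w"]) fastforce+
  ultimately show ?case by simp
qed simp

lemma first_overshoot:
  fixes c :: real
  assumes "c \<le> 1" "1 < c + sum_list ys"
  obtains hs w rest where "ys = hs @ w # rest" "c + sum_list hs \<le> 1" "1 < c + sum_list hs + w"
proof -
  have "\<exists>hs w rest. ys = hs @ w # rest \<and> c + sum_list hs \<le> 1 \<and> 1 < c + sum_list hs + w"
    using assms
  proof (induction ys arbitrary: c)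
    case (Cons y ys)
    show ?case
    proof (cases "c + y \<le> 1")
      case True
      with Cons.IH[of "c + y"] Cons.prems obtain hs w rest where
        "ys = hs @ w # rest" "c + y + sum_list hs \<le> 1" "1 < c + y + sum_list hs + w"
        by (auto simp: add.assoc)
      then show ?thesis
        by (intro exI[of _ "y # hs"] exI[of _ w] exI[of _ rest]) (auto simp: add.assoc)
    next
      case False
      with Cons.prems show ?thesis
        by (intro exI[of _ "[]"] exI[of _ y] exI[of _ ys]) auto
    qed
  qed simp
  with that show thesis by blast
qed

lemma sum_sq_ge:
  assumes "\<forall>h\<in>set hs. w \<le> h" "0 \<le> w"
  shows "w * sum_list hs \<le> sum_sq hs"
  using assms
proof (induction hs)
  case (Cons h hs)
  then have "w * h \<le> h\<^sup>2" by (simp add: power2_eq_square mult_right_mono)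
  with Cons show ?case by (simp add: algebra_simps)
qed simp

section \<open>The numerical inequality\<close>

text \<open>\<open>R\<close> bounds the variance ratio when all signs of the prefix agree, and \<open>r\<close> bounds it at every
later stop. For \<open>w \<le> 1/3\<close> the bounds are those for \<open>s = 1 - w\<close>, \<open>U = w * s\<close> and \<open>z = w\<close>; the ratio
\<open>(1 - w - z\<^sup>2) / (2 - z)\<^sup>2\<close> increases in \<open>z\<close> up to \<open>(1 - w) / 2\<close>, which is at least \<open>w\<close> exactly in this range.
For \<open>w > 1/3\<close> one has \<open>s > 2/3\<close> and \<open>U > 2/9\<close>, so the values at \<open>w = 1/3\<close> suffice.\<close>

lemma variance_ratios:
  fixes w s U :: real
  assumes w: "0 < w" and s: "s \<le> 1" "1 - w < s" "2 * w \<le> s"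
    and U: "w * s \<le> U"
  obtains R r where "0 \<le> r" "r \<le> R" "R\<^sup>2 + r\<^sup>2 < 1/8" "1 - U \<le> R * (1 + s)\<^sup>2"
    and "\<And>z. 0 \<le> z \<Longrightarrow> z \<le> w \<Longrightarrow> 1 - (U + w\<^sup>2) - z\<^sup>2 \<le> r * (2 - z)\<^sup>2"
proof (cases "w \<le> 1/3")
  case True
  define R where "R = (1 - w + w\<^sup>2) / (2 - w)\<^sup>2"
  define r where "r = (1 - w - w\<^sup>2) / (2 - w)\<^sup>2"
  have pos: "0 < (2 - w)\<^sup>2" using True by simp
  have ww: "w\<^sup>2 \<le> w / 3" using True w by (simp add: power2_eq_square)
  have U': "w - w\<^sup>2 \<le> U"
  proof -
    have "w * (1 - w) \<le> w * s" using s w by (intro mult_left_mono) auto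
    with U show ?thesis by (simp add: algebra_simps power2_eq_square)
  qed
  show thesis
  proof
    show "0 \<le> r" using pos ww True by (auto simp: r_def)
    show "r \<le> R" using pos by (auto simp: r_def R_def intro!: divide_right_mono)
    have "16 * ((1 - w + w\<^sup>2)\<^sup>2 + (1 - w - w\<^sup>2)\<^sup>2)
        = 2 * (2 - w) ^ 4 - 2 * (w\<^sup>2 * (8 * (1 - w) - 15 * w\<^sup>2))"
      by (simp add: power2_eq_square power4_eq_xxxx algebra_simps)
    moreover have "0 < w\<^sup>2 * (8 * (1 - w) - 15 * w\<^sup>2)"
      using w True ww by (intro mult_pos_pos) auto
    moreover have "a < 1/8 * b" if "16 * a = 2 * b - 2 * c" "0 < c" for a b c :: real
      using that by linarith
    ultimately have "(1 - w + w\<^sup>2)\<^sup>2 + (1 - w - w\<^sup>2)\<^sup>2 < 1/8 * (2 - w) ^ 4" by blast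
    moreover have "R\<^sup>2 + r\<^sup>2 = ((1 - w + w\<^sup>2)\<^sup>2 + (1 - w - w\<^sup>2)\<^sup>2) / (2 - w) ^ 4"
      by (simp only: R_def r_def power_divide add_divide_distrib[symmetric] power_mult[symmetric])
        simp
    moreover have "0 < (2 - w) ^ 4" using True by simp
    ultimately show "R\<^sup>2 + r\<^sup>2 < 1/8" by (simp add: divide_less_eq)
    have "1 - U \<le> 1 - w + w\<^sup>2" using U' by simp
    also have "\<dots> = R * (2 - w)\<^sup>2" using pos by (simp add: R_def)
    also have "\<dots> \<le> R * (1 + s)\<^sup>2"
      using s True \<open>0 \<le> r\<close> \<open>r \<le> R\<close> by (intro mult_left_mono power_mono) auto
    finally show "1 - U \<le> R * (1 + s)\<^sup>2" .
    fix z assume z: "0 \<le> z" "z \<le> w"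
    \<comment> \<open>After clearing denominators, the difference of the two sides vanishes at \<open>z = w\<close>;
        dividing it by \<open>w - z\<close> leaves a cofactor that decreases in \<open>z\<close> and is nonnegative at \<open>z = w\<close>.\<close>
    have "(5 - 5 * w) * z \<le> (5 - 5 * w) * w" using z True by (intro mult_left_mono) auto
    moreover have "0 \<le> 4 - 14 * w + 6 * w\<^sup>2"
    proof -
      have "0 \<le> (1/3 - w) * (12 - 6 * w)" using True by (intro mult_nonneg_nonneg) auto
      then show ?thesis by (simp add: power2_eq_square algebra_simps)
    qed
    ultimately have "0 \<le> 4 - 9 * w - 5 * z + 5 * w * z + w\<^sup>2"
      by (simp add: power2_eq_square algebra_simps)
    then have "0 \<le> (w - z) * (4 - 9 * w - 5 * z + 5 * w * z + w\<^sup>2)"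
      using z by (intro mult_nonneg_nonneg) auto
    then have "(1 - w - z\<^sup>2) * (2 - w)\<^sup>2 \<le> (1 - w - w\<^sup>2) * (2 - z)\<^sup>2"
      by (simp add: power2_eq_square algebra_simps)
    then have "1 - w - z\<^sup>2 \<le> r * (2 - z)\<^sup>2"
      using pos by (simp add: r_def pos_le_divide_eq)
    with U' show "1 - (U + w\<^sup>2) - z\<^sup>2 \<le> r * (2 - z)\<^sup>2" by simp
  qed
next
  case False
  have ws: "1/3 * (2/3) \<le> w * s" using False s by (intro mult_mono) auto
  have w2: "1/3 * (1/3) \<le> w * w" using False by (intro mult_mono) auto
  show thesis
  proof
    show "(0::real) \<le> 1/5" "1/5 \<le> (7/25::real)" by auto
    show "(7/25)\<^sup>2 + (1/5)\<^sup>2 < (1/8::real)" by (simp add: power2_eq_square)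
    have "(5/3)\<^sup>2 \<le> (1 + s)\<^sup>2" using False s by (intro power_mono) auto
    with ws U show "1 - U \<le> 7/25 * (1 + s)\<^sup>2" by (simp add: power2_eq_square)
    fix z :: real
    have "0 \<le> 6/5 * (z - 1/3)\<^sup>2" by simp
    then have "2/3 - z\<^sup>2 \<le> 1/5 * (2 - z)\<^sup>2"
      by (simp add: power2_eq_square algebra_simps)
    with ws w2 U show "1 - (U + w\<^sup>2) - z\<^sup>2 \<le> 1/5 * (2 - z)\<^sup>2"
      by (simp add: power2_eq_square)
  qed
qed

section \<open>The bound for signed sums\<close>

text \<open>Conditioning on the signs of \<open>y1\<close> and \<open>y2\<close>: if they agree, the bound with \<open>R\<close> holds, and if they
differ, the prefix cannot be extremal, so the better bound with \<open>r\<close> holds. Each case has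
probability \<open>1/2\<close>, and the mean of the two bounds exceeds \<open>13/32\<close> because \<open>R\<^sup>2 + r\<^sup>2 < 1/8\<close>.\<close>

lemma in_unit_walk_gt:
  assumes tail: "\<And>x. \<bar>x\<bar> \<le> 1 \<Longrightarrow> 1/2 \<le> signed_mean in_unit zs x"
    and sorted: "sorted_wrt (\<ge>) (y1 # y2 # ys)" and nonneg: "\<forall>y\<in>set (y1 # y2 # ys). 0 \<le> y"
    and le1: "y1 + y2 \<le> 1" and sq: "sum_sq (y1 # y2 # ys @ zs) \<le> 1"
  shows "13/32 < signed_mean in_unit (y1 # y2 # ys @ zs) 0"
proof (cases "y1 + y2 + sum_list ys \<le> 1")
  case True
  have "1/2 \<le> signed_mean (signed_mean in_unit zs) (y1 # y2 # ys) 0"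
    using True nonneg tail by (intro signed_mean_ge[where B = 1 and f = "signed_mean in_unit zs"]) auto
  also have "\<dots> = signed_mean in_unit (y1 # y2 # ys @ zs) 0"
    by (simp add: signed_mean_append)
  finally show ?thesis by linarith
next
  case False
  then have "1 < y1 + y2 + sum_list ys" by simp
  then obtain hs w rest where ys: "ys = hs @ w # rest"
    and split: "y1 + y2 + sum_list hs \<le> 1" "1 < y1 + y2 + sum_list hs + w"
    by (rule first_overshoot[OF le1])
  define s where "s = y1 + y2 + sum_list hs"
  define U where "U = sum_sq (y1 # y2 # hs)"
  have s: "s \<le> 1" "1 - w < s" using split by (auto simp: s_def)
  have w: "0 < w" using s by simp
  have big: "\<forall>h\<in>set (y1 # y2 # hs). w \<le> h" and y21: "y2 \<le> y1"
    using sorted by (auto simp: ys sorted_wrt_append)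
  have hs0: "0 \<le> sum_list hs" using nonneg by (auto simp: ys intro: sum_list_nonneg)
  have U: "w * s \<le> U"
    using sum_sq_ge[OF big] w by (simp add: s_def U_def add.assoc)
  have w2: "2 * w \<le> s" using big hs0 by (simp add: s_def)
  obtain R r where
    Rr: "0 \<le> r" "r \<le> R" "R\<^sup>2 + r\<^sup>2 < 1/8" "1 - U \<le> R * (1 + s)\<^sup>2"
    and r: "\<And>z. 0 \<le> z \<Longrightarrow> z \<le> w \<Longrightarrow> 1 - (U + w\<^sup>2) - z\<^sup>2 \<le> r * (2 - z)\<^sup>2"
    by (rule variance_ratios[OF w s w2 U]) (rule that)
  define F where "F = signed_mean in_unit (w # rest @ zs)"
  have remaining: "sum_sq (w # rest @ zs) \<le> 1 - U"
    using sq by (simp add: ys U_def)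
  have F_all: "1/2 - 3/2 * R\<^sup>2 \<le> F s"
    unfolding F_def using remaining Rr s w w2 by (intro in_unit_prob_ge) auto
  have F_mixed: "1/2 - 3/2 * r\<^sup>2 \<le> F z" if z: "\<bar>z\<bar> \<le> s - 2 * w" for z
  proof (cases rest)
    case Nil
    have "1/2 \<le> signed_mean (signed_mean in_unit zs) [w] z"
      using z s w by (intro signed_mean_ge[where B = 1] tail) auto
    then have "1/2 \<le> F z" by (simp add: F_def Nil)
    moreover have "1/2 - 3/2 * r\<^sup>2 \<le> 1/2" by simp
    ultimately show ?thesis by linarith
  next
    case (Cons w' rest')
    have w': "0 \<le> w'" "w' \<le> w"
      using sorted nonneg by (auto simp: ys Cons sorted_wrt_append)
    have "sum_sq (rest' @ zs) \<le> 1 - (U + w\<^sup>2) - w'\<^sup>2"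
      using remaining by (simp add: Cons)
    moreover have "sorted_wrt (\<ge>) (w' # rest')" "\<forall>v\<in>set (w' # rest'). 0 \<le> v"
      using sorted nonneg by (auto simp: ys Cons sorted_wrt_append)
    moreover have "w \<le> 1" using s w w2 by linarith
    ultimately have "1/2 - 3/2 * r\<^sup>2 \<le> signed_mean in_unit (rest' @ zs) y" if "\<bar>y\<bar> \<le> 1" for y
      using tail r Rr(1) w' that by (intro signed_mean_ge_if_variance_spent[where w = w and m = w' and A = "U + w\<^sup>2"])
    then have "1/2 - 3/2 * r\<^sup>2 \<le> signed_mean (signed_mean in_unit (rest' @ zs)) [w, w'] z"
      using z s w w' by (intro signed_mean_ge[where B = 1 and f = "signed_mean in_unit (rest' @ zs)"]) auto
    then show ?thesis by (simp add: F_def Cons)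
  qed
  have r_le_R: "1/2 - 3/2 * R\<^sup>2 \<le> 1/2 - 3/2 * r\<^sup>2"
    using Rr by (simp add: power_mono)
  have same: "1/2 - 3/2 * R\<^sup>2 \<le> signed_mean F hs (y1 + y2)"
    using w big F_all order_trans[OF r_le_R F_mixed]
    by (intro signed_mean_ge_extremal[where w = w]) (auto simp: s_def)
  have diff: "1/2 - 3/2 * r\<^sup>2 \<le> signed_mean F hs (y1 - y2)"
    using nonneg big y21 F_mixed
    by (intro signed_mean_ge[where B = "s - 2 * w"]) (auto simp: s_def ys)
  have even: "signed_mean F hs (- x) = signed_mean F hs x" for x
    by (intro signed_mean_even) (simp only: F_def signed_mean_even in_unit_minus)
  have "signed_mean in_unit (y1 # y2 # ys @ zs) 0 = signed_mean F (y1 # y2 # hs) 0"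
    by (simp only: F_def ys append_Cons append_assoc flip: signed_mean_append)
  also have "\<dots> = (signed_mean F hs (y1 + y2) + signed_mean F hs (y1 - y2)) / 2"
    using even[of "y1 + y2"] even[of "y1 - y2"] by (simp add: add_divide_distrib)
  also have "13/32 < \<dots>" using same diff Rr(3) by (simp add: field_simps)
  finally show ?thesis .
qed

text \<open>Reduction to the ordered situation of the previous lemma. Padding with zeros provides the four
largest absolute values for short lists too.\<close>

lemma in_unit_signed_sum_gt:
  assumes "sum_sq vs \<le> 1"
  shows "13/32 < signed_mean in_unit vs 0"
proof -
  define us where "us = rev (sort (map abs vs @ replicate 4 0))"
  have "length us \<ge> 4" by (simp add: us_def)
  then obtain u1 u2 u3 u4 ys where us: "us = u1 # u2 # u3 # u4 # ys"
    by (auto simp: numeral_eq_Suc Suc_le_length_iff)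
  have sorted: "sorted_wrt (\<ge>) us"
    by (simp add: us_def sorted_wrt_rev)
  have mset_us: "mset us = mset (map abs vs @ replicate 4 0)"
    by (simp add: us_def)
  have nonneg: "\<forall>u\<in>set us. 0 \<le> u" by (auto simp: us_def)
  have "sum_sq us = sum_sq (map abs vs @ replicate 4 0)"
    by (metis mset_us mset_map sum_mset_sum_list)
  also have "\<dots> = sum_sq vs" by (simp add: o_def sum_list_replicate)
  finally have sq: "sum_sq us \<le> 1" using assms by simp
  have o: "u2 \<le> u1" "u3 \<le> u2" "u4 \<le> u3" "0 \<le> u4"
    using sorted nonneg by (auto simp: us)
  have sq4: "u1\<^sup>2 + u2\<^sup>2 + u3\<^sup>2 + u4\<^sup>2 \<le> 1"
    using sq sum_sq_nonneg[of ys] by (simp add: us)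
  have "u1\<^sup>2 \<le> u1\<^sup>2 + u2\<^sup>2 + u3\<^sup>2 + u4\<^sup>2" by simp
  with sq4 have "u1\<^sup>2 \<le> 1" by linarith
  then have u1: "u1 \<le> 1" by (simp add: power2_le_imp_le)
  have le1: "u2 + u4 \<le> 1"
  proof (rule ccontr)
    assume gt: "\<not> u2 + u4 \<le> 1"
    have "1 < (u2 + u4)\<^sup>2" using gt by (simp add: one_less_power)
    also have "\<dots> \<le> 2 * u2\<^sup>2 + 2 * u4\<^sup>2"
      using zero_le_power2[of "u2 - u4"] by (simp add: power2_eq_square algebra_simps)
    also have "\<dots> \<le> u1\<^sup>2 + u2\<^sup>2 + u3\<^sup>2 + u4\<^sup>2"
    proof -
      have "u2\<^sup>2 \<le> u1\<^sup>2" "u4\<^sup>2 \<le> u3\<^sup>2" using o by (auto intro!: power_mono)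
      then show ?thesis by linarith
    qed
    finally show False using sq4 by simp
  qed
  have "signed_mean in_unit vs 0 = signed_mean in_unit (map abs vs @ replicate 4 0) 0"
    by (simp only: signed_mean_snoc_zeros signed_mean_abs)
  also have "\<dots> = signed_mean in_unit (u2 # u4 # ys @ [u3, u1]) 0"
    by (rule signed_mean_mset_cong) (simp only: mset_us[symmetric], simp add: us)
  also have "13/32 < \<dots>"
    using sorted nonneg o u1 sq le1
    by (intro in_unit_walk_gt in_unit_two_steps_ge) (auto simp: us)
  finally show ?thesis .
qed

section \<open>Independent random signs\<close>

lemma integral_uniform_sign:
  fixes g :: "real \<Rightarrow> real"
  assumes "g \<in> borel_measurable borel"
  shows "integral\<^sup>L (distr (measure_pmf (pmf_of_set {-1, 1 :: real})) borel (\<lambda>x. x)) g = (g 1 + g (- 1)) / 2"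
proof -
  have "integral\<^sup>L (distr (measure_pmf (pmf_of_set {-1, 1 :: real})) borel (\<lambda>x. x)) g
      = measure_pmf.expectation (pmf_of_set {-1, 1}) g"
    using assms by (intro integral_distr) auto
  also have "\<dots> = (g 1 + g (- 1)) / 2"
    by (subst integral_pmf_of_set) auto
  finally show ?thesis .
qed

lemma integral_PiM_uniform_sign:
  fixes f :: "real \<Rightarrow> real" and v :: "'i \<Rightarrow> real"
  defines "D \<equiv> distr (measure_pmf (pmf_of_set {-1, 1 :: real})) borel (\<lambda>x. x)"
  assumes f: "f \<in> borel_measurable borel" "\<And>z. \<bar>f z\<bar> \<le> B"
    and "distinct is"
  shows "(\<integral>s. f (x + (\<Sum>i\<in>set is. s i * v i)) \<partial>Pi\<^sub>M (set is) (\<lambda>_. D)) = signed_mean f (map v is) x"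
  using \<open>distinct is\<close>
proof (induction "is" arbitrary: x)
  case Nil
  show ?case by (simp add: PiM_empty lebesgue_integral_count_space_finite)
next
  case (Cons j js)
  interpret D: prob_space D
    unfolding D_def by (intro prob_space.prob_space_distr prob_space_measure_pmf) simp
  interpret P: product_prob_space "\<lambda>_ :: 'i. D" UNIV ..
  have sets_D [measurable_cong]: "sets D = sets borel" by (simp add: D_def)
  note f(1) [measurable]
  have integrable: "integrable (Pi\<^sub>M I (\<lambda>_. D)) (\<lambda>s. f (g s))"
    if [measurable]: "g \<in> borel_measurable (Pi\<^sub>M I (\<lambda>_. D))" for I :: "'i set" and g
  proof -
    interpret PI: prob_space "Pi\<^sub>M I (\<lambda>_. D)"
      by (intro prob_space_PiM D.prob_space_axioms)
    show ?thesis
      using f(2) by (intro PI.integrable_const_bound[where B = B]) auto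
  qed
  have meas: "(\<lambda>s. y + (\<Sum>i\<in>J. s i * v i)) \<in> borel_measurable (Pi\<^sub>M J (\<lambda>_. D))" for y J
    by measurable
  let ?T = "\<lambda>s. \<Sum>i\<in>set js. s i * v i"
  have "(\<integral>s. f (x + (\<Sum>i\<in>set (j # js). s i * v i)) \<partial>Pi\<^sub>M (set (j # js)) (\<lambda>_. D))
      = (\<integral>s. (\<integral>y. f (x + (\<Sum>i\<in>insert j (set js). (s(j := y)) i * v i)) \<partial>D) \<partial>Pi\<^sub>M (set js) (\<lambda>_. D))"
    using Cons.prems unfolding list.set
    by (intro P.product_integral_insert integrable meas) auto
  also have "\<dots> = (\<integral>s. (\<integral>y. f (x + y * v j + ?T s) \<partial>D) \<partial>Pi\<^sub>M (set js) (\<lambda>_. D))"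
  proof -
    have "(\<Sum>i\<in>insert j (set js). (s(j := y)) i * v i) = y * v j + ?T s" for s y
      using Cons.prems by (auto intro: sum.cong)
    then show ?thesis by (simp add: add.assoc)
  qed
  also have "\<dots> = (\<integral>s. (f (x + v j + ?T s) + f (x - v j + ?T s)) / 2 \<partial>Pi\<^sub>M (set js) (\<lambda>_. D))"
    unfolding D_def by (subst integral_uniform_sign) auto
  also have "\<dots> = ((\<integral>s. f (x + v j + ?T s) \<partial>Pi\<^sub>M (set js) (\<lambda>_. D))
      + (\<integral>s. f (x - v j + ?T s) \<partial>Pi\<^sub>M (set js) (\<lambda>_. D))) / 2"
    by (subst Bochner_Integration.integral_divide_zero, subst Bochner_Integration.integral_add)
       (auto intro!: integrable meas)
  also have "\<dots> = signed_mean f (map v (j # js)) x"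
    using Cons.prems Cons.IH by simp
  finally show ?case .
qed

theorem mainTheorem1:
  fixes M :: "'a measure" and n :: nat
    and v :: "nat \<Rightarrow> real" and a :: "nat \<Rightarrow> 'a \<Rightarrow> real"
  assumes "prob_space M"
    and "(\<Sum>i=1..n. (v i)\<^sup>2) \<le> 1"
    and "\<And>i. i \<in> {1..n} \<Longrightarrow> random_sign M (a i)"
    and "prob_space.indep_vars M (\<lambda>_. borel) a {1..n}"
  shows "measure M {\<omega> \<in> space M. \<bar>\<Sum>i=1..n. a i \<omega> * v i\<bar> \<le> 1} > 13 / 32"
proof (cases "n = 0")
  case True
  interpret prob_space M by fact
  show ?thesis using True by (simp add: prob_space)
next
  case False
  interpret prob_space M by fact
  define D where "D = distr (measure_pmf (pmf_of_set {-1, 1 :: real})) borel (\<lambda>x. x)"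
  have a [measurable]: "a i \<in> borel_measurable M" and law: "distr M borel (a i) = D"
    if "i \<in> {1..n}" for i
    using assms(3)[OF that] by (auto simp: random_sign_def D_def)
  have in_unit [measurable]: "in_unit \<in> borel_measurable borel"
    unfolding in_unit_def by measurable
  \<comment> \<open>By independence the joint law of the signs is a product measure, on which the event is a
      function of the coordinates.\<close>
  let ?joint = "\<lambda>\<omega>. \<lambda>i\<in>{1..n}. a i \<omega>"
  have "distr M (Pi\<^sub>M {1..n} (\<lambda>_. borel)) ?joint = Pi\<^sub>M {1..n} (\<lambda>i. distr M borel (a i))"
    using indep_vars_iff_distr_eq_PiM'[where I = "{1..n}" and M' = "\<lambda>_. borel" and X = a] assms(4) a False by auto
  also have "\<dots> = Pi\<^sub>M {1..n} (\<lambda>_. D)"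
    using law by (intro PiM_cong) auto
  finally have joint: "distr M (Pi\<^sub>M {1..n} (\<lambda>_. borel)) ?joint = Pi\<^sub>M {1..n} (\<lambda>_. D)" .
  have "measure M {\<omega> \<in> space M. \<bar>\<Sum>i=1..n. a i \<omega> * v i\<bar> \<le> 1}
      = (\<integral>\<omega>. indicator {\<omega> \<in> space M. \<bar>\<Sum>i=1..n. a i \<omega> * v i\<bar> \<le> 1} \<omega> \<partial>M)"
    by simp
  also have "\<dots> = (\<integral>\<omega>. in_unit (0 + (\<Sum>i\<in>{1..n}. ?joint \<omega> i * v i)) \<partial>M)"
    by (intro Bochner_Integration.integral_cong) (auto simp: in_unit_def indicator_def)
  also have "\<dots> = (\<integral>s. in_unit (0 + (\<Sum>i\<in>{1..n}. s i * v i)) \<partial>distr M (Pi\<^sub>M {1..n} (\<lambda>_. borel)) ?joint)"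
  proof (rule integral_distr[symmetric])
    show "?joint \<in> measurable M (Pi\<^sub>M {1..n} (\<lambda>_. borel))"
      by (intro measurable_restrict a)
    have "(\<lambda>s. 0 + (\<Sum>i\<in>{1..n}. s i * v i)) \<in> borel_measurable (Pi\<^sub>M {1..n} (\<lambda>_. borel))"
      by measurable
    from measurable_compose[OF this in_unit]
    show "(\<lambda>s. in_unit (0 + (\<Sum>i\<in>{1..n}. s i * v i))) \<in> borel_measurable (Pi\<^sub>M {1..n} (\<lambda>_. borel))" .
  qed
  also have "\<dots> = signed_mean in_unit (map v [1..<Suc n]) 0"
    unfolding joint
    using integral_PiM_uniform_sign[of in_unit 1 "[1..<Suc n]" 0 v]
    by (simp add: D_def in_unit_def atLeastLessThanSuc_atLeastAtMost del: upt_Suc)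
  also have "13/32 < \<dots>"
  proof (rule in_unit_signed_sum_gt)
    have "sum_sq (map v [1..<Suc n]) = (\<Sum>i=1..n. (v i)\<^sup>2)"
      by (simp add: o_def interv_sum_list_conv_sum_set_nat atLeastLessThanSuc_atLeastAtMost del: upt_Suc)
    with assms(2) show "sum_sq (map v [1..<Suc n]) \<le> 1" by simp
  qed
  finally show ?thesis .
qed

end
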